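(* Let $X$ be a Banach space, let $J$ be a proximinal subspace of $X$, and let $J_0$ be the metric complement of $J$. Then: (i) If $J_0$ is a linear subspace of $X$, then $(X,J)$ has the quotient lifting property (QLP). (ii) $J_0$ is a linear subspace of $X$ if and only if $J$ is Chebyshev and $P_J$ is linear.
   Context: For a closed subspace $J$ of a Banach space $X$, $\pi:X\to X/J$ is the quotient map. The pair $(X,J)$ has the quotient lifting property (QLP) if for every Banach space $Y$ and every bounded linear operator $S:Y\to X/J$ there is a bounded linear operator $T:Y\to X$ with $\pi\circ T=S$ and $\|T\|=\|S\|$. The metric projection onto $J$ is the set-valued map $P_J(x)=\{j\in J:\|x-j\|=\mathrm{dist}(x,J)\}$; $J$ is proximinal (resp. Chebyshev) if $P_J(x)$ is nonempty (resp. a singleton) for every $x\in X$. When $J$ is Chebyshev, $P_J$ is regarded as a map $X\to J$. The metric complement of $J$ is the set $J_0=\{x\in X:\|x\|=\mathrm{dist}(x,J)\}$. *)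

theory Defs
  imports "HOL-Analysis.Analysis"
begin

text \<open>
  Banach spaces over \<open>'k\<close>, which is the real or the complex field (up to isomorphism these
  are the only instances of \<^class>\<open>real_normed_field\<close>). Completeness comes from the
  class \<^class>\<open>banach\<close>. The assumption \<open>scale_of_real\<close> says that the
  \<open>scaleR\<close> built into the type is the restriction of \<open>smul\<close> to the reals.
\<close>

locale banach_space = vector_space smul
  for smul :: "'k::real_normed_field \<Rightarrow> 'a::banach \<Rightarrow> 'a" +
  assumes norm_scale: "norm (smul c x) = norm c * norm x"
    and scale_of_real: "smul (of_real r) x = r *\<^sub>R x"

lemma banach_space_real: "banach_space (scaleR :: real \<Rightarrow> 'a::banach \<Rightarrow> 'a)"
  by unfold_locales (simp_all add: algebra_simps)

lemma banach_space_complex: "banach_space ((*) :: complex \<Rightarrow> complex \<Rightarrow> complex)"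
  by unfold_locales (simp_all add: algebra_simps norm_mult scaleR_conv_of_real)

definition metric_projection :: "'a::real_normed_vector set \<Rightarrow> 'a \<Rightarrow> 'a set" where
  "metric_projection J x = {j \<in> J. norm (x - j) = infdist x J}"

definition proximinal :: "'a::real_normed_vector set \<Rightarrow> bool" where
  "proximinal J \<longleftrightarrow> (\<forall>x. metric_projection J x \<noteq> {})"

definition chebyshev :: "'a::real_normed_vector set \<Rightarrow> bool" where
  "chebyshev J \<longleftrightarrow> (\<forall>x. is_singleton (metric_projection J x))"

text \<open>Meaningful only if \<open>J\<close> is Chebyshev.\<close>

definition metric_projection_map :: "'a::real_normed_vector set \<Rightarrow> 'a \<Rightarrow> 'a" where
  "metric_projection_map J x = the_elem (metric_projection J x)"

definition metric_complement :: "'a::real_normed_vector set \<Rightarrow> 'a set" where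
  "metric_complement J = {x. norm x = infdist x J}"

text \<open>
  \<open>X/J\<close> depends on the term \<open>J\<close>, so it is represented by the set of cosets
  \<open>x +o J\<close> rather than by a type. Addition of cosets is the elementwise sum of sets;
  in the scalar multiple the summand \<open>J\<close> matters for \<open>c = 0\<close> only.
\<close>

definition quotient_map :: "'a::real_normed_vector set \<Rightarrow> 'a \<Rightarrow> 'a set" where
  "quotient_map J x = x +o J"

definition quotient_space :: "'a::real_normed_vector set \<Rightarrow> 'a set set" where
  "quotient_space J = range (quotient_map J)"

definition quotient_scale ::
    "('k \<Rightarrow> 'a \<Rightarrow> 'a) \<Rightarrow> 'a::real_normed_vector set \<Rightarrow> 'k \<Rightarrow> 'a set \<Rightarrow> 'a set" where
  "quotient_scale smul J c A = smul c ` A + J"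

definition quotient_norm :: "'a::real_normed_vector set \<Rightarrow> real" where
  "quotient_norm A = (INF a\<in>A. norm a)"

lemma (in banach_space) quotient_map_add:
  assumes "subspace J"
  shows "quotient_map J (x + y) = quotient_map J x + quotient_map J y"
proof (intro equalityI subsetI)
  fix z assume "z \<in> quotient_map J (x + y)"
  then obtain j where j: "j \<in> J" "z = (x + j) + (y + 0)"
    by (auto simp: quotient_map_def elt_set_plus_def algebra_simps)
  then show "z \<in> quotient_map J x + quotient_map J y"
    using subspace_0[OF assms]
    unfolding quotient_map_def elt_set_plus_def set_plus_def by blast
next
  fix z assume "z \<in> quotient_map J x + quotient_map J y"
  then obtain j k where j: "j \<in> J" "k \<in> J" "z = (x + j) + (y + k)"
    by (auto simp: quotient_map_def elt_set_plus_def set_plus_def)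
  then have "z = (x + y) + (j + k)" by (simp add: algebra_simps)
  then show "z \<in> quotient_map J (x + y)"
    using subspace_add[OF assms j(1,2)]
    unfolding quotient_map_def elt_set_plus_def by blast
qed

lemma (in banach_space) quotient_map_scale:
  assumes "subspace J"
  shows "quotient_map J (smul c x) = quotient_scale smul J c (quotient_map J x)"
proof (intro equalityI subsetI)
  fix z assume "z \<in> quotient_map J (smul c x)"
  then obtain j where j: "j \<in> J" "z = smul c (x + 0) + j"
    by (auto simp: quotient_map_def elt_set_plus_def)
  then show "z \<in> quotient_scale smul J c (quotient_map J x)"
    using subspace_0[OF assms]
    unfolding quotient_map_def quotient_scale_def elt_set_plus_def set_plus_def by blast
next
  fix z assume "z \<in> quotient_scale smul J c (quotient_map J x)"
  then obtain j k where j: "j \<in> J" "k \<in> J" "z = smul c (x + j) + k"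
    by (auto simp: quotient_map_def quotient_scale_def elt_set_plus_def set_plus_def)
  then have "z = smul c x + (smul c j + k)"
    by (simp add: scale_right_distrib add.assoc)
  then show "z \<in> quotient_map J (smul c x)"
    using subspace_add[OF assms subspace_scale[OF assms j(1)] j(2)]
    unfolding quotient_map_def elt_set_plus_def by blast
qed

lemma (in banach_space) quotient_norm_quotient_map:
  assumes "subspace J"
  shows "quotient_norm (quotient_map J x) = infdist x J"
proof -
  have "norm ` quotient_map J x = dist x ` J"
  proof (intro equalityI subsetI)
    fix r assume "r \<in> norm ` quotient_map J x"
    then obtain j where "j \<in> J" "r = norm (x + j)"
      by (auto simp: quotient_map_def elt_set_plus_def)
    then have "- j \<in> J" "r = dist x (- j)"
      using subspace_neg[OF assms] by (auto simp: dist_norm)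
    then show "r \<in> dist x ` J" by blast
  next
    fix r assume "r \<in> dist x ` J"
    then obtain j where "j \<in> J" "r = norm (x + - j)"
      by (auto simp: dist_norm)
    then show "r \<in> norm ` quotient_map J x"
      using subspace_neg[OF assms]
      unfolding quotient_map_def elt_set_plus_def by blast
  qed
  then show ?thesis
    using subspace_0[OF assms] by (auto simp: quotient_norm_def infdist_def)
qed

definition quotient_bounded_linear ::
    "('k \<Rightarrow> 'y::real_normed_vector \<Rightarrow> 'y) \<Rightarrow> ('k \<Rightarrow> 'a::real_normed_vector \<Rightarrow> 'a) \<Rightarrow> 'a set
      \<Rightarrow> ('y \<Rightarrow> 'a set) \<Rightarrow> bool" where
  "quotient_bounded_linear smulY smul J S \<longleftrightarrow>
     range S \<subseteq> quotient_space J \<and>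
     (\<forall>y z. S (y + z) = S y + S z) \<and>
     (\<forall>c y. S (smulY c y) = quotient_scale smul J c (S y)) \<and>
     (\<exists>K. \<forall>y. quotient_norm (S y) \<le> norm y * K)"

text \<open>The formula is that of \<^const>\<open>onorm\<close>.\<close>

definition quotient_onorm :: "('y::real_normed_vector \<Rightarrow> 'a::real_normed_vector set) \<Rightarrow> real" where
  "quotient_onorm S = (SUP y. quotient_norm (S y) / norm y)"

text \<open>
  \<^const>\<open>bounded_linear\<close> refers to real scalars, hence the separate requirement of
  linearity over \<open>'k\<close>. The Banach space \<open>Y\<close> ranges over all Banach space
  structures over \<open>'k\<close> that extend the type \<open>'y\<close>; a theorem concluding the
  property for a type variable \<open>'y\<close> asserts it for every \<open>Y\<close>.
\<close>

definition quotient_lifting_property ::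
    "'y::banach itself \<Rightarrow> ('k::real_normed_field \<Rightarrow> 'a::banach \<Rightarrow> 'a) \<Rightarrow> 'a set \<Rightarrow> bool" where
  "quotient_lifting_property Y smul J \<longleftrightarrow>
     (\<forall>(smulY :: 'k \<Rightarrow> 'y \<Rightarrow> 'y) S.
        banach_space smulY \<longrightarrow> quotient_bounded_linear smulY smul J S \<longrightarrow>
        (\<exists>T. bounded_linear T \<and> Vector_Spaces.linear smulY smul T \<and>
             quotient_map J \<circ> T = S \<and> onorm T = quotient_onorm S))"

end

theory Submission
  imports Defs
begin

text \<open>
  Translating by elements of \<open>J\<close> does not change the distance to \<open>J\<close>, so \<open>j \<in> J\<close> is a nearest
  point to \<open>x\<close> exactly if \<open>x - j\<close> lies in the metric complement \<open>J\<^sub>0\<close>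
  (\<open>mem_metric_projection_iff\<close>). The nearest points to \<open>x\<close> thus correspond to the elements of
  \<open>J\<^sub>0\<close> in the coset \<open>x + J\<close>; proximinality says that every coset meets \<open>J\<^sub>0\<close>.

  If \<open>J\<^sub>0\<close> is a subspace, two points of \<open>J\<^sub>0\<close> in the same coset differ by an element of
  \<open>J \<inter> J\<^sub>0 = {0}\<close>. Sending a coset to its only point in \<open>J\<^sub>0\<close> is then a linear section of the
  quotient map, and it is isometric because the points of \<open>J\<^sub>0\<close> are those whose norm equals the
  quotient norm of their coset. Composing an operator into the quotient with this section lifts it
  without changing its norm, which is the quotient lifting property. Subtracting the section from
  the identity gives the metric projection, which is therefore single-valued and linear.

  Conversely, if \<open>J\<close> is Chebyshev, then \<open>J\<^sub>0\<close> is the set of zeros of the metric projection, so it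
  is a subspace as soon as the projection is linear.
\<close>

section \<open>Nearest points and the metric complement\<close>

lemma (in banach_space) quotient_map_eq_iff:
  assumes "subspace J"
  shows "quotient_map J x = quotient_map J y \<longleftrightarrow> x - y \<in> J"
proof
  assume eq: "quotient_map J x = quotient_map J y"
  have "x \<in> quotient_map J x"
    using subspace_0[OF assms] by (force simp: quotient_map_def elt_set_plus_def)
  then have "x \<in> quotient_map J y" using eq by simp
  then show "x - y \<in> J" by (auto simp: quotient_map_def elt_set_plus_def)
next
  have sub: "quotient_map J u \<subseteq> quotient_map J v" if "u - v \<in> J" for u v
  proof
    fix w assume "w \<in> quotient_map J u"
    then obtain j where "j \<in> J" "w = v + ((u - v) + j)"
      by (auto simp: quotient_map_def elt_set_plus_def)
    then show "w \<in> quotient_map J v"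
      using subspace_add[OF assms that] unfolding quotient_map_def elt_set_plus_def by blast
  qed
  assume "x - y \<in> J"
  moreover from this have "y - x \<in> J" using subspace_neg[OF assms] by fastforce
  ultimately show "quotient_map J x = quotient_map J y" using sub by blast
qed

lemma (in banach_space) mem_quotient_map_iff:
  assumes "subspace J"
  shows "z \<in> quotient_map J x \<longleftrightarrow> quotient_map J z = quotient_map J x"
proof -
  have "z \<in> quotient_map J x \<longleftrightarrow> z - x \<in> J"
    by (force simp: quotient_map_def elt_set_plus_def)
  then show ?thesis using quotient_map_eq_iff[OF assms] by simp
qed

lemma (in banach_space) metric_complement_iff_quotient_norm:
  assumes "subspace J"
  shows "z \<in> metric_complement J \<longleftrightarrow> norm z = quotient_norm (quotient_map J z)"
  by (simp add: metric_complement_def quotient_norm_quotient_map[OF assms])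

lemma (in banach_space) mem_metric_projection_iff:
  assumes "subspace J"
  shows "j \<in> metric_projection J x \<longleftrightarrow> j \<in> J \<and> x - j \<in> metric_complement J"
proof -
  have "infdist (x - j) J = infdist x J" if "j \<in> J"
  proof -
    have "quotient_map J (x - j) = quotient_map J x"
      using that subspace_neg[OF assms] by (simp add: quotient_map_eq_iff[OF assms])
    then show ?thesis by (simp flip: quotient_norm_quotient_map[OF assms])
  qed
  then show ?thesis by (auto simp: metric_projection_def metric_complement_def)
qed

lemma Int_metric_complement: "x \<in> J \<Longrightarrow> x \<in> metric_complement J \<Longrightarrow> x = 0"
  by (simp add: metric_complement_def)

section \<open>The isometric section of the quotient map\<close>

definition metric_section :: "'a::real_normed_vector set \<Rightarrow> 'a set \<Rightarrow> 'a" where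
  "metric_section J A = (THE z. z \<in> A \<and> z \<in> metric_complement J)"

text \<open>
  A point of the coset \<open>x + J\<close> in the metric complement is \<open>x - j\<close> for a nearest point \<open>j\<close> to
  \<open>x\<close>. Two such points differ by an element of \<open>J\<close>, and their difference stays in the metric
  complement since the latter is a subspace.
\<close>

lemma (in banach_space) ex1_metric_complement_in_coset:
  assumes J: "subspace J" and prox: "proximinal J"
    and J0: "subspace (metric_complement J)" and A: "A \<in> quotient_space J"
  shows "\<exists>!z. z \<in> A \<and> z \<in> metric_complement J"
proof -
  obtain x where x: "A = quotient_map J x" using A by (auto simp: quotient_space_def)
  obtain j where "j \<in> metric_projection J x" using prox by (auto simp: proximinal_def)
  then have j: "j \<in> J" "x - j \<in> metric_complement J"
    by (simp_all add: mem_metric_projection_iff[OF J])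
  show ?thesis
  proof (rule ex1I[of _ "x - j"])
    show "x - j \<in> A \<and> x - j \<in> metric_complement J"
      using j subspace_neg[OF J]
      by (simp add: x mem_quotient_map_iff[OF J] quotient_map_eq_iff[OF J])
  next
    fix z assume z: "z \<in> A \<and> z \<in> metric_complement J"
    then have "z - x \<in> J"
      by (simp add: x mem_quotient_map_iff[OF J] quotient_map_eq_iff[OF J])
    then have "(z - x) + j \<in> J" using j subspace_add[OF J] by blast
    then have "z - (x - j) \<in> J" by (simp add: algebra_simps)
    moreover have "z - (x - j) \<in> metric_complement J" using z j subspace_diff[OF J0] by blast
    ultimately have "z - (x - j) = 0" by (rule Int_metric_complement)
    then show "z = x - j" by simp
  qed
qed

lemma (in banach_space) metric_section:
  assumes "subspace J" and "proximinal J"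
    and "subspace (metric_complement J)" and "A \<in> quotient_space J"
  shows metric_section_mem: "metric_section J A \<in> A"
    and metric_section_complement: "metric_section J A \<in> metric_complement J"
  using theI'[OF ex1_metric_complement_in_coset[OF assms]]
  by (auto simp: metric_section_def)

lemma (in banach_space) metric_section_eqI:
  assumes "subspace J" and "proximinal J"
    and "subspace (metric_complement J)" and "A \<in> quotient_space J"
    and "z \<in> A" and "z \<in> metric_complement J"
  shows "metric_section J A = z"
  using the1_equality[OF ex1_metric_complement_in_coset[OF assms(1-4)]] assms(5,6)
  by (simp add: metric_section_def)

lemma (in banach_space) quotient_map_metric_section:
  assumes "subspace J" and "proximinal J"
    and "subspace (metric_complement J)" and A: "A \<in> quotient_space J"
  shows "quotient_map J (metric_section J A) = A"
  using A metric_section_mem[OF assms] mem_quotient_map_iff[OF assms(1)]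
  by (auto simp: quotient_space_def)

lemma (in banach_space) norm_metric_section:
  assumes "subspace J" and "proximinal J"
    and "subspace (metric_complement J)" and "A \<in> quotient_space J"
  shows "norm (metric_section J A) = quotient_norm A"
  using metric_section_complement[OF assms] quotient_map_metric_section[OF assms]
  by (simp add: metric_complement_iff_quotient_norm[OF assms(1)])

lemma (in banach_space) quotient_space_add:
  assumes "subspace J" and "A \<in> quotient_space J" and "B \<in> quotient_space J"
  shows "A + B \<in> quotient_space J"
  using assms(2,3) by (auto simp: quotient_space_def simp flip: quotient_map_add[OF assms(1)])

lemma (in banach_space) quotient_space_scale:
  assumes "subspace J" and "A \<in> quotient_space J"
  shows "quotient_scale smul J c A \<in> quotient_space J"
  using assms(2) by (auto simp: quotient_space_def simp flip: quotient_map_scale[OF assms(1)])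

lemma (in banach_space) metric_section_add:
  assumes J: "subspace J" and prox: "proximinal J"
    and J0: "subspace (metric_complement J)"
    and A: "A \<in> quotient_space J" and B: "B \<in> quotient_space J"
  shows "metric_section J (A + B) = metric_section J A + metric_section J B"
proof (rule metric_section_eqI[OF J prox J0 quotient_space_add[OF J A B]])
  show "metric_section J A + metric_section J B \<in> A + B"
    using metric_section_mem[OF J prox J0] A B by (auto intro: set_plus_intro)
  show "metric_section J A + metric_section J B \<in> metric_complement J"
    using metric_section_complement[OF J prox J0] A B subspace_add[OF J0] by blast
qed

lemma (in banach_space) metric_section_scale:
  assumes J: "subspace J" and prox: "proximinal J"
    and J0: "subspace (metric_complement J)" and A: "A \<in> quotient_space J"
  shows "metric_section J (quotient_scale smul J c A) = smul c (metric_section J A)"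
proof (rule metric_section_eqI[OF J prox J0 quotient_space_scale[OF J A]])
  have "smul c (metric_section J A) + 0 \<in> quotient_scale smul J c A"
    unfolding quotient_scale_def
    by (intro set_plus_intro imageI metric_section_mem[OF J prox J0 A] subspace_0[OF J])
  then show "smul c (metric_section J A) \<in> quotient_scale smul J c A" by simp
  show "smul c (metric_section J A) \<in> metric_complement J"
    using metric_section_complement[OF J prox J0 A] subspace_scale[OF J0] by blast
qed

section \<open>The quotient lifting property\<close>

text \<open>
  The lift of \<open>S\<close> is its composition with the section. It has the norm of \<open>S\<close> because the section
  preserves norms pointwise.
\<close>

lemma (in banach_space) quotient_lifting_propertyI:
  assumes J: "subspace J" and prox: "proximinal J"
    and J0: "subspace (metric_complement J)"
  shows "quotient_lifting_property TYPE('y::banach) smul J"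
  unfolding quotient_lifting_property_def
proof (intro allI impI)
  fix smulY :: "'k \<Rightarrow> 'y \<Rightarrow> 'y" and S
  assume Y: "banach_space smulY" and S: "quotient_bounded_linear smulY smul J S"
  interpret Y: banach_space smulY by (rule Y)
  have mem: "S y \<in> quotient_space J" for y
    using S by (auto simp: quotient_bounded_linear_def)
  define T where "T y = metric_section J (S y)" for y
  have add: "T (y + z) = T y + T z" for y z
    using S by (simp add: T_def quotient_bounded_linear_def metric_section_add[OF J prox J0 mem mem])
  have scale: "T (smulY c y) = smul c (T y)" for c y
    using S by (simp add: T_def quotient_bounded_linear_def metric_section_scale[OF J prox J0 mem])
  have norm: "norm (T y) = quotient_norm (S y)" for y
    by (simp add: T_def norm_metric_section[OF J prox J0 mem])
  obtain K where K: "\<And>y. quotient_norm (S y) \<le> norm y * K"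
    using S by (auto simp: quotient_bounded_linear_def)
  have "bounded_linear T"
  proof (rule bounded_linear_intro[OF add])
    show "T (r *\<^sub>R y) = r *\<^sub>R T y" for r y
      using scale[of "of_real r" y] by (simp add: scale_of_real Y.scale_of_real)
    show "norm (T y) \<le> norm y * K" for y using K norm by simp
  qed
  moreover have "Vector_Spaces.linear smulY smul T"
    by unfold_locales (fact add scale)+
  moreover have "quotient_map J \<circ> T = S"
    by (simp add: fun_eq_iff T_def quotient_map_metric_section[OF J prox J0 mem])
  moreover have "onorm T = quotient_onorm S"
    by (simp add: onorm_def quotient_onorm_def norm)
  ultimately show "\<exists>T. bounded_linear T \<and> Vector_Spaces.linear smulY smul T \<and>
      quotient_map J \<circ> T = S \<and> onorm T = quotient_onorm S" by blast
qed

section \<open>Linearity of the metric projection\<close>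

lemma (in banach_space) metric_projection_eq_section:
  assumes J: "subspace J" and prox: "proximinal J"
    and J0: "subspace (metric_complement J)"
  shows "metric_projection J x = {x - metric_section J (quotient_map J x)}"
proof -
  have mem: "quotient_map J x \<in> quotient_space J" by (simp add: quotient_space_def)
  have "j = x - metric_section J (quotient_map J x)" if "j \<in> metric_projection J x" for j
  proof -
    have "x - j \<in> quotient_map J x" "x - j \<in> metric_complement J"
      using that subspace_neg[OF J]
      by (auto simp: mem_metric_projection_iff[OF J] mem_quotient_map_iff[OF J]
          quotient_map_eq_iff[OF J])
    then have "metric_section J (quotient_map J x) = x - j"
      by (rule metric_section_eqI[OF J prox J0 mem])
    then show ?thesis by simp
  qed
  moreover have "metric_projection J x \<noteq> {}" using prox by (simp add: proximinal_def)
  ultimately show ?thesis by blast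
qed

lemma (in banach_space) linear_metric_projection_map:
  assumes J: "subspace J" and prox: "proximinal J"
    and J0: "subspace (metric_complement J)"
  shows "Vector_Spaces.linear smul smul (metric_projection_map J)"
proof -
  have P: "metric_projection_map J x = x - metric_section J (quotient_map J x)" for x
    by (simp add: metric_projection_map_def metric_projection_eq_section[OF assms])
  have mem: "quotient_map J x \<in> quotient_space J" for x by (simp add: quotient_space_def)
  show ?thesis
    by unfold_locales
      (simp_all add: P quotient_map_add[OF J] quotient_map_scale[OF J] scale_right_diff_distrib
        metric_section_add[OF assms mem mem] metric_section_scale[OF assms mem])
qed

lemma (in banach_space) metric_complement_eq_kernel:
  assumes J: "subspace J" and "chebyshev J"
  shows "metric_complement J = {x. metric_projection_map J x = 0}"
proof -
  have "metric_projection J x = {metric_projection_map J x}" for x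
    using assms(2) by (simp add: chebyshev_def metric_projection_map_def is_singleton_the_elem)
  then have "0 \<in> metric_projection J x \<longleftrightarrow> metric_projection_map J x = 0" for x by auto
  then show ?thesis
    using subspace_0[OF J] by (auto simp: mem_metric_projection_iff[OF J])
qed

theorem proposition11:
  fixes smul :: "'k::real_normed_field \<Rightarrow> 'a::banach \<Rightarrow> 'a"
    and J :: "'a set"
  assumes "banach_space smul"
    and "module.subspace smul J"
    and "closed J"
    and "proximinal J"
  shows "(module.subspace smul (metric_complement J) \<longrightarrow>
            quotient_lifting_property TYPE('y::banach) smul J) \<and>
         (module.subspace smul (metric_complement J) \<longleftrightarrow>
            chebyshev J \<and> Vector_Spaces.linear smul smul (metric_projection_map J))"
proof -
  interpret banach_space smul by (rule assms(1))
  note J = assms(2) and prox = assms(4)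
  have "chebyshev J \<and> Vector_Spaces.linear smul smul (metric_projection_map J)"
    if J0: "subspace (metric_complement J)"
    using linear_metric_projection_map[OF J prox J0]
    by (simp add: chebyshev_def metric_projection_eq_section[OF J prox J0])
  moreover have "subspace (metric_complement J)"
    if "chebyshev J" and lin: "Vector_Spaces.linear smul smul (metric_projection_map J)"
  proof -
    interpret P: Vector_Spaces.linear smul smul "metric_projection_map J" by (rule lin)
    show ?thesis
      using P.subspace_kernel by (simp add: metric_complement_eq_kernel[OF J that(1)])
  qed
  ultimately show ?thesis using quotient_lifting_propertyI[OF J prox] by blast
qed

end
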